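(* There is a sufficiently small constant $\delta>0$ such that any randomized protocol in the $k$-site coordinator model that computes $\varepsilon$-approximate all-quantile, or $\varepsilon$-approximate $\min\{\frac12,\frac{\varepsilon\sqrt k}{2}\}$-heavy hitters, of the union of the sites' multisets with error probability $\delta$ has communication complexity $\Omega(\min\{\sqrt k/\varepsilon, 1/\varepsilon^2\})$ bits.
   Context: Coordinator model: $k$ sites $S_1,\dots,S_k$ and a coordinator; site $S_i$ holds a multiset $A_i$ of items from the ordered universe $[N]$; communication only between coordinator and sites, cost = total bits exchanged. Let $A$ be the multiset union, $m=|A|$, $f_x$ the frequency of $x$ in $A$. $\phi$-heavy hitters: $H_\phi(A)=\{x: f_x\ge\phi m\}$; an $\varepsilon$-approximate answer is a set containing $H_\phi(A)$ and containing no $x$ with $f_x<(\phi-\varepsilon)m$. A $\phi$-quantile of $A$ is an $x$ such that at most $\phi m$ items of $A$ are smaller than $x$ and at most $(1-\phi)m$ are greater; an $\varepsilon$-approximate $\phi$-quantile is any $\phi'$-quantile with $\phi-\varepsilon\le\phi'\le\phi+\varepsilon$. $\varepsilon$-approximate all-quantile: at the end the coordinator constructs a data structure from which an $\varepsilon$-approximate $\phi$-quantile can be extracted for every $0\le\phi\le1$.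
   Formalization: The bound is proved for all k ≥ k₀, 0 < ε ≤ ε₀, universe size N ≥ C·max{1, 1/(ε√k)} and every total size m ≥ C·min{√k/ε, 1/ε²}, with absolute constants; without such conditions it fails (N = 1, or heavy hitters with k ≤ 4, cost zero bits). *)

theory Defs
  imports "HOL-Probability.Probability"
begin

text \<open>
  The coordinator's side of a deterministic protocol, as a protocol tree. Sites are numbered from 0.
  Messages are exchanged bit by bit: \<open>Send i b\<close> transmits the bit \<open>b\<close> to site \<open>i\<close>, while \<open>Receive i\<close>
  takes one bit from site \<open>i\<close> and branches on it. The coordinator has no input, so what it does next
  is a function of the bits it has received. A message of several bits is a sequence of such steps;
  there are no empty messages, so silence and timing carry no information.
\<close>

datatype 'o coordinator =
    Output 'o
  | Send nat bool "'o coordinator"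
  | Receive nat "bool \<Rightarrow> 'o coordinator"

text \<open>
  A site sees only its own multiset and its own conversation with the coordinator, recorded with
  directions as seen from the site.
\<close>

datatype event = Got bool | Sent bool

type_synonym site_rule = "nat multiset \<Rightarrow> event list \<Rightarrow> bool"

type_synonym 'o det_protocol = "'o coordinator \<times> (nat \<Rightarrow> site_rule)"

primrec addressees :: "'o coordinator \<Rightarrow> nat set" where
  "addressees (Output y) = {}"
| "addressees (Send i b T) = insert i (addressees T)"
| "addressees (Receive i T) = insert i (\<Union>b. addressees (T b))"

text \<open>
  \<open>run T s A h\<close> is the pair of the output and the number of bits exchanged, where \<open>h i\<close> is the
  conversation of site \<open>i\<close> with the coordinator so far.
\<close>

primrec run ::
  "'o coordinator \<Rightarrow> (nat \<Rightarrow> site_rule) \<Rightarrow> (nat \<Rightarrow> nat multiset) \<Rightarrow> (nat \<Rightarrow> event list) \<Rightarrow> 'o \<times> nat"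
where
  "run (Output y) s A h = (y, 0)"
| "run (Send i b T) s A h = map_prod id Suc (run T s A (h(i := h i @ [Got b])))"
| "run (Receive i T) s A h =
     (let b = s i (A i) (h i) in map_prod id Suc (run (T b) s A (h(i := h i @ [Sent b]))))"

definition output_of :: "'o det_protocol \<Rightarrow> (nat \<Rightarrow> nat multiset) \<Rightarrow> 'o" where
  "output_of P A = fst (run (fst P) (snd P) A (\<lambda>_. []))"

definition bits_of :: "'o det_protocol \<Rightarrow> (nat \<Rightarrow> nat multiset) \<Rightarrow> nat" where
  "bits_of P A = snd (run (fst P) (snd P) A (\<lambda>_. []))"

text \<open>
  A randomized protocol is a probability space of deterministic protocols for the \<open>k\<close> sites
  \<open>0, \<dots>, k - 1\<close>. This allows arbitrary public coins, and hence also private ones.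
\<close>

definition randomized_protocol :: "nat \<Rightarrow> 'o det_protocol measure \<Rightarrow> bool" where
  "randomized_protocol k R \<longleftrightarrow>
     prob_space R \<and> (\<forall>P\<in>space R. addressees (fst P) \<subseteq> {..<k})"

definition site_union :: "nat \<Rightarrow> (nat \<Rightarrow> nat multiset) \<Rightarrow> nat multiset" where
  "site_union k A = (\<Sum>i<k. A i)"

text \<open>
  The total size \<open>m\<close> is a parameter of the problem, like \<open>k\<close> and the universe size \<open>N\<close>: over
  multisets of unbounded size the worst-case number of bits would be infinite for trivial reasons.
\<close>

definition inputs :: "nat \<Rightarrow> nat \<Rightarrow> nat \<Rightarrow> (nat \<Rightarrow> nat multiset) set" where
  "inputs k N m =
     {A. (\<forall>i<k. set_mset (A i) \<subseteq> {1..N}) \<and> size (site_union k A) = m}"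

definition communication :: "nat \<Rightarrow> nat \<Rightarrow> nat \<Rightarrow> 'o det_protocol measure \<Rightarrow> ereal" where
  "communication k N m R =
     (SUP P\<in>space R. SUP A\<in>inputs k N m. ereal (real (bits_of P A)))"

text \<open>
  \<open>correct B y\<close> says that \<open>y\<close> is an admissible answer for the union \<open>B\<close>. The set \<open>E\<close> is there because
  the error event itself need not be measurable; if it is, the condition says that its probability
  is at most \<open>\<delta>\<close>.
\<close>

definition computes_with_error ::
  "real \<Rightarrow> nat \<Rightarrow> nat \<Rightarrow> nat \<Rightarrow> (nat multiset \<Rightarrow> 'o \<Rightarrow> bool) \<Rightarrow> 'o det_protocol measure \<Rightarrow> bool"
where
  "computes_with_error \<delta> k N m correct R \<longleftrightarrow>
     (\<forall>A\<in>inputs k N m. \<exists>E\<in>sets R.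
        {P\<in>space R. \<not> correct (site_union k A) (output_of P A)} \<subseteq> E \<and> measure R E \<le> \<delta>)"

definition heavy_hitters :: "nat \<Rightarrow> real \<Rightarrow> nat multiset \<Rightarrow> nat set" where
  "heavy_hitters N \<phi> B = {x\<in>{1..N}. real (count B x) \<ge> \<phi> * real (size B)}"

definition approx_heavy_hitters ::
  "nat \<Rightarrow> real \<Rightarrow> real \<Rightarrow> nat multiset \<Rightarrow> nat set \<Rightarrow> bool"
where
  "approx_heavy_hitters N \<epsilon> \<phi> B S \<longleftrightarrow>
     S \<subseteq> {1..N} \<and> heavy_hitters N \<phi> B \<subseteq> S \<and>
     \<not> (\<exists>x\<in>S. real (count B x) < (\<phi> - \<epsilon>) * real (size B))"

definition is_quantile :: "nat \<Rightarrow> real \<Rightarrow> nat multiset \<Rightarrow> nat \<Rightarrow> bool" where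
  "is_quantile N \<phi> B x \<longleftrightarrow>
     x \<in> {1..N} \<and>
     real (size {#y \<in># B. y < x#}) \<le> \<phi> * real (size B) \<and>
     real (size {#y \<in># B. y > x#}) \<le> (1 - \<phi>) * real (size B)"

definition approx_quantile :: "nat \<Rightarrow> real \<Rightarrow> real \<Rightarrow> nat multiset \<Rightarrow> nat \<Rightarrow> bool" where
  "approx_quantile N \<epsilon> \<phi> B x \<longleftrightarrow>
     (\<exists>\<phi>'. \<phi> - \<epsilon> \<le> \<phi>' \<and> \<phi>' \<le> \<phi> + \<epsilon> \<and> is_quantile N \<phi>' B x)"

text \<open>A data structure for all quantiles is represented by its query function \<open>q\<close>.\<close>

definition approx_all_quantile ::
  "nat \<Rightarrow> real \<Rightarrow> nat multiset \<Rightarrow> (real \<Rightarrow> nat) \<Rightarrow> bool"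
where
  "approx_all_quantile N \<epsilon> B q \<longleftrightarrow>
     (\<forall>\<phi>. 0 \<le> \<phi> \<and> \<phi> \<le> 1 \<longrightarrow> approx_quantile N \<epsilon> \<phi> B (q \<phi>))"

end

theory Submission imports Defs begin

text \<open>
  Put \<open>q = min (sqrt k) (1 / \<epsilon>)\<close>. About \<open>q\<^sup>2\<close> sites receive about \<open>1 / (\<epsilon> q)\<close> independent uniform
  signs each, encoded as items so that a correct answer reveals, for every \<open>j\<close>, the sign of the column
  sum \<open>W j\<close> whenever \<open>\<bar>W j\<bar>\<close> is at least a small constant times its standard deviation. Averaging over
  the coins fixes one deterministic protocol, correct on most sign patterns. It follows that the
  conditional means \<open>M j\<close> of \<open>W j\<close> given the transcript have absolute value of order \<open>q\<close> on average,
  since \<open>E \<bar>W j\<bar>\<close> has that order and the answer is a function of the transcript.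

  The inputs compatible with a transcript form a combinatorial rectangle, so the rows remain independent
  given the transcript and \<open>E (M j)\<^sup>2\<close> is the sum of the expected squared conditional means of the
  individual signs in column \<open>j\<close>. By the level-1 inequality, the sum of these over all \<open>j\<close> is at most
  twice the entropy of the transcript, hence \<open>O(D)\<close> for \<open>D\<close> bits of communication. Comparing both bounds,
  \<open>D\<close> is at least of the order of the number of signs, \<open>q / \<epsilon>\<close>.
\<close>

section \<open>Uniform random signs\<close>

definition signs :: "'a set \<Rightarrow> ('a \<Rightarrow> real) set" where
  "signs I = (\<Pi>\<^sub>E p\<in>I. {-1, 1})"

lemma finite_signs: "finite I \<Longrightarrow> finite (signs I)"
  by (simp add: signs_def finite_PiE)

lemma card_signs: "finite I \<Longrightarrow> card (signs I) = 2 ^ card I"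
proof -
  have "card {-1, 1 :: real} = 2" by auto
  then show "finite I \<Longrightarrow> card (signs I) = 2 ^ card I"
    by (simp only: signs_def card_PiE prod_constant)
qed

lemma signs_nonempty: "signs I \<noteq> {}"
  by (simp add: signs_def PiE_eq_empty_iff)

lemma signs_cases: "x \<in> signs I \<Longrightarrow> p \<in> I \<Longrightarrow> x p = -1 \<or> x p = 1"
  by (auto simp: signs_def PiE_iff)

lemma signs_square: "x \<in> signs I \<Longrightarrow> p \<in> I \<Longrightarrow> (x p)\<^sup>2 = 1"
  using signs_cases[of x I p] by auto

lemma signs_mix:
  assumes "x \<in> signs I" "x' \<in> signs I" and z: "\<And>p. z p = x p \<or> z p = x' p"
  shows "z \<in> signs I"
  using assms(1,2) unfolding signs_def
  by (intro PiE_I) (metis PiE_mem z, metis PiE_arb z)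

lemma bij_betw_flip_sign:
  assumes "p \<in> I"
  shows "bij_betw (\<lambda>x. x(p := - x p)) (signs I) (signs I)"
proof -
  have "x(p := - x p) \<in> signs I" if "x \<in> signs I" for x
    unfolding signs_def
  proof (rule PiE_I)
    fix q assume "q \<in> I"
    then show "(x(p := - x p)) q \<in> {-1, 1}"
      using signs_cases[OF that, of q] by auto
  next
    fix q assume "q \<notin> I"
    then show "(x(p := - x p)) q = undefined"
      using PiE_arb[OF that[unfolded signs_def]] assms by auto
  qed
  then show ?thesis
    by (intro bij_betwI[where g = "\<lambda>x. x(p := - x p)"] funcsetI) (blast, blast, simp_all)
qed

section \<open>Moments of sums of independent signs\<close>

lemma sum_signs_independent_eq_0:
  assumes "p \<in> I" and "\<And>x. F (x(p := - x p)) = F x"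
  shows "(\<Sum>x\<in>signs I. F x * x p) = 0"
proof -
  \<comment> \<open>Flipping coordinate \<open>p\<close> permutes \<open>signs I\<close> and negates
    every summand, so the sum equals its own negative.\<close>
  have "(\<Sum>x\<in>signs I. F x * x p) = (\<Sum>x\<in>signs I. F (x(p := - x p)) * (x(p := - x p)) p)"
    by (rule sum.reindex_bij_betw[OF bij_betw_flip_sign[OF assms(1)], symmetric])
  also have "\<dots> = - (\<Sum>x\<in>signs I. F x * x p)"
    by (simp add: assms(2) sum_negf)
  finally show ?thesis by simp
qed

lemma sum_signs_second_moment:
  assumes I: "finite I" and "J \<subseteq> I"
  shows "(\<Sum>x\<in>signs I. (\<Sum>p\<in>J. x p)\<^sup>2) = card J * real (card (signs I))"
proof -
  have "finite J" using assms finite_subset by blast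
  then show ?thesis using \<open>J \<subseteq> I\<close>
  proof (induction J rule: finite_induct)
    case empty
    then show ?case by simp
  next
    case (insert p J)
    let ?V = "\<lambda>x. \<Sum>q\<in>J. x q"
    have V: "?V (x(p := - x p)) = ?V x" for x :: "'a \<Rightarrow> real"
      using insert.hyps by (intro sum.cong) auto
    have "(\<Sum>x\<in>signs I. (\<Sum>q\<in>insert p J. x q)\<^sup>2) = (\<Sum>x\<in>signs I. 1 + (?V x)\<^sup>2 + 2 * (?V x * x p))"
      using insert.hyps insert.prems
      by (intro sum.cong refl) (simp add: power2_sum signs_square)
    also have "\<dots> = card (signs I) + (\<Sum>x\<in>signs I. (?V x)\<^sup>2) + 2 * (\<Sum>x\<in>signs I. ?V x * x p)"
      by (simp add: sum.distrib sum_distrib_left)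
    also have "(\<Sum>x\<in>signs I. ?V x * x p) = 0"
      using insert V by (intro sum_signs_independent_eq_0) auto
    finally show ?case
      using insert by (simp add: algebra_simps)
  qed
qed

text \<open>Coordinates are added one at a time: odd powers of the new sign average to 0 and even
  powers are 1. With \<open>n = card J\<close> the exact mean is
  \<open>3 * n^2 - 2 * n\<close>.\<close>

lemma sum_signs_fourth_moment:
  assumes I: "finite I" and "J \<subseteq> I"
  shows "(\<Sum>x\<in>signs I. (\<Sum>p\<in>J. x p) ^ 4) \<le> 3 * (real (card J))\<^sup>2 * card (signs I)"
proof -
  have "finite J" using assms finite_subset by blast
  then show ?thesis using \<open>J \<subseteq> I\<close>
  proof (induction J rule: finite_induct)
    case empty
    then show ?case by simp
  next
    case (insert p J)
    let ?V = "\<lambda>x. \<Sum>q\<in>J. x q"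
    have V: "?V (x(p := - x p)) = ?V x" for x :: "'a \<Rightarrow> real"
      using insert.hyps by (intro sum.cong) auto
    have expand: "(s + v) ^ 4 = 1 + 6 * v\<^sup>2 + v ^ 4 + (4 * v ^ 3 + 4 * v) * s"
      if "s = -1 \<or> s = 1" for v s :: real
      using that by (elim disjE) (simp_all add: power4_eq_xxxx power3_eq_cube power2_eq_square algebra_simps)
    have "(\<Sum>x\<in>signs I. (\<Sum>q\<in>insert p J. x q) ^ 4)
        = (\<Sum>x\<in>signs I. 1 + 6 * (?V x)\<^sup>2 + ?V x ^ 4 + (4 * ?V x ^ 3 + 4 * ?V x) * x p)"
      using insert.hyps insert.prems expand[OF signs_cases] by (intro sum.cong refl) auto
    also have "\<dots> = card (signs I) + 6 * (\<Sum>x\<in>signs I. (?V x)\<^sup>2) + (\<Sum>x\<in>signs I. ?V x ^ 4)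
        + (\<Sum>x\<in>signs I. (4 * ?V x ^ 3 + 4 * ?V x) * x p)"
      by (simp add: sum.distrib sum_distrib_left)
    also have "(\<Sum>x\<in>signs I. (4 * ?V x ^ 3 + 4 * ?V x) * x p) = 0"
      using insert V by (intro sum_signs_independent_eq_0) auto
    also have "(\<Sum>x\<in>signs I. (?V x)\<^sup>2) = card J * real (card (signs I))"
      using insert I by (intro sum_signs_second_moment) auto
    also have "(\<Sum>x\<in>signs I. ?V x ^ 4) \<le> 3 * (real (card J))\<^sup>2 * card (signs I)"
      using insert by simp
    finally show ?case
      using insert by (simp add: algebra_simps power2_eq_square)
  qed
qed

text \<open>A Khintchine-type bound. Let \<open>u\<close> be the sum over a nonempty
  \<open>J\<close> divided by \<open>sqrt (card J)\<close>. Averaging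
  \<open>u^2 - u^4 / 4 \<le> \<bar>u\<bar>\<close>, where the second moment is 1 and the fourth at
  most 3, leaves \<open>1 - 3 / 4\<close>.\<close>

lemma sum_signs_abs_ge:
  assumes I: "finite I" and "J \<subseteq> I"
  shows "sqrt (card J) / 4 * card (signs I) \<le> (\<Sum>x\<in>signs I. \<bar>\<Sum>p\<in>J. x p\<bar>)"
proof (cases "card J = 0")
  case False
  define s where "s = sqrt (card J)"
  have s: "s > 0" "s\<^sup>2 = card J" using False by (auto simp: s_def)
  \<comment> \<open>bounds the first absolute moment from below by the second and the fourth\<close>
  have "u\<^sup>2 - u ^ 4 / 4 \<le> u" if "u \<ge> 0" for u :: real
  proof -
    \<comment> \<open>The target is \<open>u^3 - 4 * u + 4 \<ge> 0\<close>, whose left side is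
      smallest at \<open>2 / sqrt 3\<close>; \<open>a = 6 / 5\<close> is a nearby rational. Here
      \<open>(u + 2 * a) * (u - a)^2 = u^3 - 3 * a^2 * u + 2 * a^3\<close> with
      \<open>3 * a^2 \<ge> 4\<close> and \<open>2 * a^3 \<le> 4\<close>.\<close>
    have "0 \<le> (u + 12 / 5) * (u - 6 / 5)\<^sup>2"
      using that by simp
    also have "\<dots> = u ^ 3 - 108 / 25 * u + 432 / 125"
      by (simp add: power2_eq_square power3_eq_cube field_simps)
    finally have "0 \<le> u ^ 3 / 4 - u + 1"
      using that by simp
    then have "0 \<le> u * (u ^ 3 / 4 - u + 1)" using that by (intro mult_nonneg_nonneg) auto
    then show ?thesis by (simp add: power2_eq_square power3_eq_cube power4_eq_xxxx algebra_simps)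
  qed
  from this[of "\<bar>w\<bar> / s" for w]
  have "s * ((\<bar>w\<bar> / s)\<^sup>2 - (\<bar>w\<bar> / s) ^ 4 / 4) \<le> s * (\<bar>w\<bar> / s)" for w
    using s by (intro mult_left_mono) auto
  moreover have "s * ((\<bar>w\<bar> / s)\<^sup>2 - (\<bar>w\<bar> / s) ^ 4 / 4) = w\<^sup>2 / s - w ^ 4 / (4 * s ^ 3)" for w
    using s(1) by (simp add: power_divide field_simps eval_nat_numeral)
  ultimately have le: "w\<^sup>2 / s - w ^ 4 / (4 * s ^ 3) \<le> \<bar>w\<bar>" for w
    using s(1) by simp
  have "s / 4 * card (signs I) = (card J * real (card (signs I))) / s
      - (3 * (real (card J))\<^sup>2 * card (signs I)) / (4 * s ^ 3)"
    using s(1) unfolding s(2)[symmetric] by (simp add: field_simps eval_nat_numeral)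
  also have "\<dots> \<le> (\<Sum>x\<in>signs I. (\<Sum>p\<in>J. x p)\<^sup>2) / s - (\<Sum>x\<in>signs I. (\<Sum>p\<in>J. x p) ^ 4) / (4 * s ^ 3)"
    using s sum_signs_fourth_moment[OF assms] sum_signs_second_moment[OF assms]
    by (intro diff_mono divide_right_mono) auto
  also have "\<dots> = (\<Sum>x\<in>signs I. (\<Sum>p\<in>J. x p)\<^sup>2 / s - (\<Sum>p\<in>J. x p) ^ 4 / (4 * s ^ 3))"
    by (simp add: sum_subtractf sum_divide_distrib)
  also have "\<dots> \<le> (\<Sum>x\<in>signs I. \<bar>\<Sum>p\<in>J. x p\<bar>)"
    by (intro sum_mono le)
  finally show ?thesis by (simp add: s_def)
qed simp

section \<open>Exponential moments, the level-1 inequality and entropy\<close>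

lemma exp_plus_exp_minus_le:
  fixes x :: real
  shows "exp x + exp (- x) \<le> 2 * exp (x\<^sup>2 / 2)"
proof -
  have *: "exp x + exp (- x) \<le> 2 * exp (x\<^sup>2 / 2)" if "x > 0" for x :: real
  proof -
    \<comment> \<open>Hoeffding's lemma for a fair two-point variable whose values are
      \<open>2 * x\<close> apart.\<close>
    have "- (2 * x) * (1 / 2) + ln (1 + (1 / 2) * (exp (2 * x) - 1)) \<le> (2 * x)\<^sup>2 / 8"
      using that by (intro Hoeffdings_lemma_aux) auto
    then have "ln ((1 + exp (2 * x)) / 2) \<le> x + x\<^sup>2 / 2"
      by (simp add: field_simps)
    then have "exp (ln ((1 + exp (2 * x)) / 2)) \<le> exp (x + x\<^sup>2 / 2)"
      by (simp only: exp_le_cancel_iff)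
    also have "exp (ln ((1 + exp (2 * x)) / 2)) = (1 + exp (2 * x)) / 2"
      by (intro exp_ln) (simp add: add_pos_pos)
    finally have "exp (- x) * (1 + exp (2 * x)) \<le> exp (- x) * (2 * exp (x + x\<^sup>2 / 2))"
      by (intro mult_left_mono) auto
    then show ?thesis
      by (simp add: distrib_left mult_exp_exp mult.left_commute[of _ 2] add.commute)
  qed
  show ?thesis
    using *[of x] *[of "- x"] by (cases x "0::real" rule: linorder_cases) (auto simp: add.commute)
qed

lemma sum_signs_exp_le:
  assumes "finite I"
  shows "(\<Sum>x\<in>signs I. exp (\<Sum>p\<in>I. b p * x p)) \<le> card (signs I) * exp ((\<Sum>p\<in>I. (b p)\<^sup>2) / 2)"
proof -
  have "(\<Sum>x\<in>signs I. exp (\<Sum>p\<in>I. b p * x p)) = (\<Prod>p\<in>I. \<Sum>s\<in>{-1, 1}. exp (b p * s))"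
    using assms by (subst prod_sum_PiE) (auto simp: signs_def exp_sum)
  also have "\<dots> \<le> (\<Prod>p\<in>I. 2 * exp ((b p)\<^sup>2 / 2))"
    using exp_plus_exp_minus_le by (intro prod_mono) (auto simp: add.commute)
  also have "\<dots> = card (signs I) * exp ((\<Sum>p\<in>I. (b p)\<^sup>2) / 2)"
    using assms by (simp add: prod.distrib card_signs exp_sum sum_divide_distrib)
  finally show ?thesis .
qed

text \<open>
  The level-1 inequality: Jensen's inequality for \<open>exp\<close>, applied to the linear form whose
  coefficients are the means \<open>b\<close> themselves.
\<close>

lemma level_one_inequality:
  assumes I: "finite I" and L: "L \<subseteq> signs I" "L \<noteq> {}"
  defines "b \<equiv> (\<lambda>p. (\<Sum>x\<in>L. x p) / card L)"
  shows "(\<Sum>p\<in>I. (b p)\<^sup>2) \<le> 2 * ln (card (signs I) / card L)"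
proof -
  have fin: "finite L" using L finite_signs[OF I] finite_subset by blast
  then have pos: "real (card L) > 0" "real (card (signs I)) > 0"
    using L finite_signs[OF I] signs_nonempty[of I] by (auto simp: card_gt_0_iff)
  let ?q = "\<Sum>p\<in>I. (b p)\<^sup>2"
  have "(\<Sum>x\<in>L. (1 / card L) *\<^sub>R (\<Sum>p\<in>I. b p * x p)) = (\<Sum>p\<in>I. b p * b p)"
    unfolding scaleR_conv_of_real sum_distrib_left
    by (subst sum.swap) (simp add: b_def sum_divide_distrib sum_distrib_left mult_ac)
  then have mean: "(\<Sum>x\<in>L. (1 / card L) *\<^sub>R (\<Sum>p\<in>I. b p * x p)) = ?q"
    by (simp add: power2_eq_square)
  have "convex_on UNIV (exp :: real \<Rightarrow> real)"
    using convex_on_exp[of 1] by simp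
  then have "exp ?q \<le> (\<Sum>x\<in>L. (1 / card L) * exp (\<Sum>p\<in>I. b p * x p))"
    unfolding mean[symmetric] using fin L pos by (intro convex_on_sum) auto
  \<comment> \<open>Passing from \<open>L\<close> to all patterns costs the inverse density of
    \<open>L\<close>. Its logarithm is the bound, and the factor 2 comes from cancelling
    \<open>?q / 2\<close> against \<open>?q\<close>.\<close>
  also have "\<dots> \<le> (\<Sum>x\<in>signs I. (1 / card L) * exp (\<Sum>p\<in>I. b p * x p))"
    using L finite_signs[OF I] by (intro sum_mono2) auto
  also have "\<dots> \<le> (1 / card L) * (card (signs I) * exp (?q / 2))"
    unfolding sum_distrib_left[symmetric] by (intro mult_left_mono sum_signs_exp_le I) auto
  also have "\<dots> = exp (ln (card (signs I) / card L) + ?q / 2)"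
    using pos by (simp add: exp_add)
  finally show ?thesis by simp
qed

text \<open>Divided by \<open>card X\<close>, the left side is the entropy in nats of
  \<open>f\<close> at a uniform point of \<open>X\<close>. It is compared with the uniform
  distribution on the image of \<open>f\<close> by \<open>ln z \<le> z - 1\<close>.\<close>

lemma sum_card_fibre_ln_le:
  fixes f :: "'a \<Rightarrow> 'b"
  assumes "finite X"
  shows "(\<Sum>x\<in>X. ln (card X / card {x'\<in>X. f x' = f x})) \<le> card X * ln (card (f ` X))"
proof (cases "X = {}")
  case False
  let ?c = "\<lambda>x. real (card {x'\<in>X. f x' = f x})" and ?K = "real (card (f ` X))"
  have K: "?K > 0" and X: "real (card X) > 0" using assms False by (auto simp: card_gt_0_iff)
  have c: "?c x > 0" if "x \<in> X" for x
    using that assms by (auto simp: card_gt_0_iff)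
  have "(\<Sum>x\<in>X. ln (card X / ?c x) - ln ?K) \<le> (\<Sum>x\<in>X. card X / ?K / ?c x - 1)"
  proof (intro sum_mono)
    fix x assume x: "x \<in> X"
    have "ln (card X / ?c x) - ln ?K = ln (card X / ?K / ?c x)"
      using K X c[OF x] by (simp add: ln_div ln_mult)
    also have "\<dots> \<le> card X / ?K / ?c x - 1"
      using K X c[OF x] by (intro ln_le_minus_one) auto
    finally show "ln (card X / ?c x) - ln ?K \<le> card X / ?K / ?c x - 1" .
  qed
  also have "\<dots> = card X / ?K * (\<Sum>x\<in>X. 1 / ?c x) - card X"
    by (simp add: sum_subtractf sum_distrib_left)
  also have "(\<Sum>x\<in>X. 1 / ?c x) = (\<Sum>l\<in>f ` X. \<Sum>x\<in>{x. x \<in> X \<and> f x = l}. 1 / ?c x)"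
    by (rule sum.image_gen[OF assms])
  also have "\<dots> = (\<Sum>l\<in>f ` X. 1)"
  proof (intro sum.cong refl)
    fix l assume "l \<in> f ` X"
    then obtain y where y: "y \<in> X" "l = f y" by blast
    have "(\<Sum>x\<in>{x. x \<in> X \<and> f x = l}. 1 / ?c x) = (\<Sum>x\<in>{x. x \<in> X \<and> f x = l}. 1 / ?c y)"
      using y by (intro sum.cong) auto
    also have "\<dots> = 1" using c[OF y(1)] y by simp
    finally show "(\<Sum>x\<in>{x. x \<in> X \<and> f x = l}. 1 / ?c x) = 1" .
  qed
  finally show ?thesis
    using K by (simp add: sum_subtractf)
qed simp

section \<open>Transcripts of deterministic protocols\<close>

text \<open>
  Only the bits received by the coordinator are recorded: they determine the bits it sends.
\<close>

primrec transcript ::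
  "'o coordinator \<Rightarrow> (nat \<Rightarrow> site_rule) \<Rightarrow> (nat \<Rightarrow> nat multiset) \<Rightarrow> (nat \<Rightarrow> event list) \<Rightarrow> bool list"
where
  "transcript (Output y) s A h = []"
| "transcript (Send i b T) s A h = transcript T s A (h(i := h i @ [Got b]))"
| "transcript (Receive i T) s A h =
     (let b = s i (A i) (h i) in b # transcript (T b) s A (h(i := h i @ [Sent b])))"

lemma length_transcript_le: "length (transcript T s A h) \<le> snd (run T s A h)"
proof (induction T arbitrary: h)
  case (Send i b T)
  then show ?case by (simp add: le_SucI)
next
  case (Receive i T)
  then show ?case by (simp add: Let_def)
qed simp

lemma output_determined_by_transcript:
  "transcript T s A h = transcript T s B h \<Longrightarrow> fst (run T s A h) = fst (run T s B h)"
proof (induction T arbitrary: h)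
  case (Receive i T)
  from Receive.prems have "s i (A i) (h i) = s i (B i) (h i)"
    by (simp add: Let_def)
  then show ?case
    using Receive.prems Receive.IH[OF rangeI, of "s i (B i) (h i)"] by (simp add: Let_def)
qed simp_all

text \<open>Every branching depends on the input of one site only. \<open>A\<close> and
  \<open>B\<close> give the same bit there, and the input \<open>C i\<close> of that site is one of
  theirs, so the run on \<open>C\<close> follows the same path.\<close>

lemma transcript_rectangle:
  "transcript T s A h = transcript T s B h \<Longrightarrow> (\<And>i. C i = A i \<or> C i = B i) \<Longrightarrow>
   transcript T s C h = transcript T s A h"
proof (induction T arbitrary: h)
  case (Receive i T)
  from Receive.prems(1) have "s i (A i) (h i) = s i (B i) (h i)"
    by (simp add: Let_def)
  moreover from this have "s i (C i) (h i) = s i (A i) (h i)"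
    using Receive.prems(2)[of i] by auto
  ultimately show ?case
    using Receive.prems Receive.IH[OF rangeI _ Receive.prems(2), of "s i (A i) (h i)"]
    by (simp add: Let_def)
qed simp_all

section \<open>Counting transcripts and fixing the coins\<close>

lemma card_bool_lists_le: "card {xs :: bool list. length xs \<le> D} \<le> 2 ^ Suc D"
proof -
  have "card {xs :: bool list. length xs \<le> D} = (\<Sum>i\<le>D. 2 ^ i)"
    using card_lists_length_le[of "UNIV :: bool set" D] by simp
  also have "\<dots> = (\<Sum>i<Suc D. 2 ^ i)"
    by (simp only: lessThan_Suc_atMost)
  also have "\<dots> \<le> 2 ^ Suc D"
    using sum_power2[of "Suc D"] by (simp add: atLeast0LessThan)
  finally show ?thesis .
qed

text \<open>The averaging step of Yao's principle: the expected number of events \<open>E x\<close>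
  that occur is at most \<open>\<delta> * card X\<close>, so some outcome does not exceed
  it.\<close>

lemma (in prob_space) exists_outcome_in_few_events:
  fixes E :: "'b \<Rightarrow> 'a set"
  assumes "finite X" and E: "\<And>x. x \<in> X \<Longrightarrow> E x \<in> events" "\<And>x. x \<in> X \<Longrightarrow> prob (E x) \<le> \<delta>"
  shows "\<exists>P\<in>space M. real (card {x\<in>X. P \<in> E x}) \<le> \<delta> * card X"
proof (rule ccontr)
  assume *: "\<not> ?thesis"
  let ?f = "\<lambda>P. \<Sum>x\<in>X. indicator (E x) P :: real"
  have int: "integrable M (indicator (E x) :: 'a \<Rightarrow> real)" if "x \<in> X" for x
    using E(1)[OF that] by (simp add: less_top[symmetric])
  have f: "?f P = card {x\<in>X. P \<in> E x}" for P
    using \<open>finite X\<close> by (simp add: indicator_def sum.If_cases Int_def)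
  have "AE P in M. \<delta> * card X < ?f P"
    using * by (intro AE_I2) (auto simp: f not_le)
  then have "\<delta> * card X < expectation ?f"
    using int by (intro expectation_greater) auto
  also have "expectation ?f = (\<Sum>x\<in>X. prob (E x))"
    using int E(1) by (subst Bochner_Integration.integral_sum) auto
  also have "\<dots> \<le> (\<Sum>x\<in>X. \<delta>)"
    by (intro sum_mono E(2))
  finally show False by (simp add: mult.commute)
qed

section \<open>Conditional means given the transcript\<close>

definition fibre :: "'a set \<Rightarrow> ('a \<Rightarrow> 'b) \<Rightarrow> 'a \<Rightarrow> 'a set" where
  "fibre X f x = {x'\<in>X. f x' = f x}"

text \<open>The conditional expectation of \<open>g\<close> given \<open>f\<close> for a uniform
  element of \<open>X\<close>.\<close>

definition fibre_mean :: "'a set \<Rightarrow> ('a \<Rightarrow> 'b) \<Rightarrow> ('a \<Rightarrow> real) \<Rightarrow> 'a \<Rightarrow> real" where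
  "fibre_mean X f g x = (\<Sum>x'\<in>fibre X f x. g x') / card (fibre X f x)"

lemma fibre_mean_sum: "fibre_mean X f (\<lambda>x. \<Sum>i\<in>J. g i x) x = (\<Sum>i\<in>J. fibre_mean X f (g i) x)"
  unfolding fibre_mean_def by (subst sum.swap) (simp add: sum_divide_distrib)

lemma card_fibre_pos: "finite X \<Longrightarrow> x \<in> X \<Longrightarrow> card (fibre X f x) > 0"
  by (auto simp: fibre_def card_gt_0_iff)

text \<open>The defining property of conditional expectation: \<open>h\<close> is constant on fibres
  and can be pulled out of each of them.\<close>

lemma sum_fibre_mean:
  assumes X: "finite X" and h: "\<And>x x'. x \<in> X \<Longrightarrow> x' \<in> X \<Longrightarrow> f x = f x' \<Longrightarrow> h x = h x'"
  shows "(\<Sum>x\<in>X. h x * fibre_mean X f g x) = (\<Sum>x\<in>X. h x * g x)"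
proof -
  have "(\<Sum>x\<in>{x. x \<in> X \<and> f x = l}. h x * fibre_mean X f g x) = (\<Sum>x\<in>{x. x \<in> X \<and> f x = l}. h x * g x)"
    if "l \<in> f ` X" for l
  proof -
    from that obtain y where y: "y \<in> X" "l = f y" by blast
    have L: "{x. x \<in> X \<and> f x = l} = fibre X f y" using y by (auto simp: fibre_def)
    have "fibre X f x = fibre X f y" "h x = h y" if "x \<in> fibre X f y" for x
      using that y h[of x y] by (simp_all add: fibre_def)
    then show ?thesis
      using card_fibre_pos[OF X y(1), of f] unfolding L
      by (simp add: fibre_mean_def flip: sum_distrib_left)
  qed
  then show ?thesis
    unfolding sum.image_gen[OF X, of "\<lambda>x. h x * fibre_mean X f g x" f]
      sum.image_gen[OF X, of "\<lambda>x. h x * g x" f]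
    by (rule sum.cong[OF refl])
qed

text \<open>Fibres are rectangles, so different rows are independent within a fibre and the product
  of the conditional means is the conditional mean of the product. Averaged over all fibres, this is
  the mean of a product of two distinct signs.\<close>

lemma sum_mult_fibre_mean_eq_0:
  fixes \<tau> :: "('a \<times> 'b \<Rightarrow> real) \<Rightarrow> 'l"
  assumes I: "finite I" "(i, j) \<in> I" "(i', j') \<in> I" and "i \<noteq> i'"
    and rect: "\<And>x x' z. x \<in> signs I \<Longrightarrow> x' \<in> signs I \<Longrightarrow> z \<in> signs I \<Longrightarrow> \<tau> x = \<tau> x' \<Longrightarrow>
      (\<And>a. (\<forall>c. z (a, c) = x (a, c)) \<or> (\<forall>c. z (a, c) = x' (a, c))) \<Longrightarrow> \<tau> z = \<tau> x"
  shows "(\<Sum>x\<in>signs I. fibre_mean (signs I) \<tau> (\<lambda>x. x (i, j)) x * fibre_mean (signs I) \<tau> (\<lambda>x. x (i', j')) x) = 0"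
proof -
  let ?m = "fibre_mean (signs I) \<tau>"
  define mix where "mix x x' = (\<lambda>(a, c). if a = i' then x' (a, c) else x (a, c))" for x x' :: "'a \<times> 'b \<Rightarrow> real"
  have mix: "mix x x' \<in> signs I" "\<tau> x = \<tau> x' \<Longrightarrow> \<tau> (mix x x') = \<tau> x"
    if "x \<in> signs I" "x' \<in> signs I" for x x'
  proof -
    show z: "mix x x' \<in> signs I"
      by (rule signs_mix[OF that]) (auto simp: mix_def)
    show "\<tau> (mix x x') = \<tau> x" if "\<tau> x = \<tau> x'"
      by (rule rect[OF \<open>x \<in> signs I\<close> \<open>x' \<in> signs I\<close> z that]) (auto simp: mix_def)
  qed
  have "?m (\<lambda>x. x (i, j)) x * ?m (\<lambda>x. x (i', j')) x = ?m (\<lambda>x. x (i, j) * x (i', j')) x" if "x \<in> signs I" for x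
  proof -
    let ?L = "fibre (signs I) \<tau> x"
    have pos: "card ?L > 0" by (rule card_fibre_pos[OF finite_signs[OF I(1)] that])
    \<comment> \<open>exchanging the rows \<open>i'\<close> of two patterns in a rectangle decouples rows \<open>i\<close> and \<open>i'\<close>\<close>
    have bij: "bij_betw (\<lambda>(x, x'). (mix x x', mix x' x)) (?L \<times> ?L) (?L \<times> ?L)"
    proof -
      have "mix y y' \<in> ?L" if "y \<in> ?L" "y' \<in> ?L" for y y'
        using that mix[of y y'] by (auto simp: fibre_def)
      moreover have "mix (mix y y') (mix y' y) = y" for y y'
        by (auto simp: mix_def fun_eq_iff)
      ultimately show ?thesis
        by (intro bij_betwI[where g = "\<lambda>(x, x'). (mix x x', mix x' x)"]) auto
    qed
    have "(\<Sum>y\<in>?L. y (i, j)) * (\<Sum>y\<in>?L. y (i', j')) = (\<Sum>(y, y')\<in>?L \<times> ?L. y (i, j) * y' (i', j'))"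
      by (simp add: sum_product sum.cartesian_product)
    also have "\<dots> = (\<Sum>z\<in>?L \<times> ?L. (\<lambda>(y, y'). y (i, j) * y' (i', j')) ((\<lambda>(x, x'). (mix x x', mix x' x)) z))"
      by (rule sum.reindex_bij_betw[OF bij, symmetric])
    also have "\<dots> = (\<Sum>(y, y')\<in>?L \<times> ?L. y (i, j) * y (i', j'))"
      using \<open>i \<noteq> i'\<close> by (intro sum.cong) (auto simp: mix_def)
    also have "\<dots> = card ?L * (\<Sum>y\<in>?L. y (i, j) * y (i', j'))"
      by (simp add: sum.cartesian_product[symmetric] sum_distrib_left)
    finally show ?thesis
      using pos by (simp add: fibre_mean_def field_simps)
  qed
  then have "(\<Sum>x\<in>signs I. ?m (\<lambda>x. x (i, j)) x * ?m (\<lambda>x. x (i', j')) x)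
      = (\<Sum>x\<in>signs I. 1 * ?m (\<lambda>x. x (i, j) * x (i', j')) x)"
    by simp
  also have "\<dots> = (\<Sum>x\<in>signs I. 1 * (x (i, j) * x (i', j')))"
    by (rule sum_fibre_mean[OF finite_signs[OF I(1)]]) simp
  also have "\<dots> = 0"
    using sum_signs_independent_eq_0[of "(i', j')" I "\<lambda>x. x (i, j)"] I \<open>i \<noteq> i'\<close> by simp
  finally show ?thesis .
qed

text \<open>Orthogonality of rows leaves only the squared means of single signs. Within each fibre
  the level-1 inequality bounds their sum over all \<open>(i, j)\<close> at once, and averaging over
  fibres turns this bound into an entropy.\<close>

lemma sum_square_fibre_mean_le:
  fixes \<tau> :: "(nat \<times> nat \<Rightarrow> real) \<Rightarrow> 'l" and n t :: nat
  defines "I \<equiv> {..<n} \<times> {..<t}"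
  assumes rect: "\<And>x x' z. x \<in> signs I \<Longrightarrow> x' \<in> signs I \<Longrightarrow> z \<in> signs I \<Longrightarrow> \<tau> x = \<tau> x' \<Longrightarrow>
      (\<And>a. (\<forall>c. z (a, c) = x (a, c)) \<or> (\<forall>c. z (a, c) = x' (a, c))) \<Longrightarrow> \<tau> z = \<tau> x"
  shows "(\<Sum>j<t. \<Sum>x\<in>signs I. (fibre_mean (signs I) \<tau> (\<lambda>x. \<Sum>i<n. x (i, j)) x)\<^sup>2)
    \<le> 2 * real (card (signs I)) * ln (card (\<tau> ` signs I))"
proof -
  have I: "finite I" by (simp add: I_def)
  let ?m = "\<lambda>i j. fibre_mean (signs I) \<tau> (\<lambda>x. x (i, j))"
  have diag: "(\<Sum>x\<in>signs I. (fibre_mean (signs I) \<tau> (\<lambda>x. \<Sum>i<n. x (i, j)) x)\<^sup>2)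
      = (\<Sum>x\<in>signs I. \<Sum>i<n. (?m i j x)\<^sup>2)" if "j < t" for j
  proof -
    have "(\<Sum>x\<in>signs I. (fibre_mean (signs I) \<tau> (\<lambda>x. \<Sum>i<n. x (i, j)) x)\<^sup>2)
        = (\<Sum>x\<in>signs I. \<Sum>i<n. \<Sum>i'<n. ?m i j x * ?m i' j x)"
      by (simp add: fibre_mean_sum power2_eq_square sum_product)
    also have "\<dots> = (\<Sum>i<n. \<Sum>x\<in>signs I. \<Sum>i'<n. ?m i j x * ?m i' j x)"
      by (rule sum.swap)
    also have "\<dots> = (\<Sum>i<n. \<Sum>i'<n. \<Sum>x\<in>signs I. ?m i j x * ?m i' j x)"
      by (intro sum.cong refl sum.swap)
    also have "\<dots> = (\<Sum>i<n. \<Sum>i'<n. if i' = i then \<Sum>x\<in>signs I. (?m i j x)\<^sup>2 else 0)"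
    proof (intro sum.cong refl)
      fix i i' assume "i \<in> {..<n}" "i' \<in> {..<n}"
      then show "(\<Sum>x\<in>signs I. ?m i j x * ?m i' j x) = (if i' = i then \<Sum>x\<in>signs I. (?m i j x)\<^sup>2 else 0)"
        using sum_mult_fibre_mean_eq_0[OF I _ _ _ rect, of i j i' j] that
        by (auto simp: power2_eq_square I_def)
    qed
    also have "\<dots> = (\<Sum>x\<in>signs I. \<Sum>i<n. (?m i j x)\<^sup>2)"
      by (subst sum.swap) simp
    finally show ?thesis .
  qed
  have "(\<Sum>j<t. \<Sum>x\<in>signs I. (fibre_mean (signs I) \<tau> (\<lambda>x. \<Sum>i<n. x (i, j)) x)\<^sup>2)
      = (\<Sum>j<t. \<Sum>x\<in>signs I. \<Sum>i<n. (?m i j x)\<^sup>2)"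
    by (simp add: diag)
  also have "\<dots> = (\<Sum>x\<in>signs I. \<Sum>j<t. \<Sum>i<n. (?m i j x)\<^sup>2)"
    by (rule sum.swap)
  also have "\<dots> = (\<Sum>x\<in>signs I. \<Sum>p\<in>I. (fibre_mean (signs I) \<tau> (\<lambda>x. x p) x)\<^sup>2)"
    unfolding I_def by (subst sum.swap) (simp add: sum.cartesian_product case_prod_unfold)
  also have "\<dots> \<le> (\<Sum>x\<in>signs I. 2 * ln (card (signs I) / card (fibre (signs I) \<tau> x)))"
  proof (rule sum_mono)
    fix x assume "x \<in> signs I"
    then show "(\<Sum>p\<in>I. (fibre_mean (signs I) \<tau> (\<lambda>x. x p) x)\<^sup>2)
        \<le> 2 * ln (card (signs I) / card (fibre (signs I) \<tau> x))"
      unfolding fibre_mean_def by (intro level_one_inequality I) (auto simp: fibre_def)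
  qed
  also have "\<dots> \<le> 2 * (card (signs I) * ln (card (\<tau> ` signs I)))"
    unfolding sum_distrib_left[symmetric] fibre_def
    by (intro mult_left_mono sum_card_fibre_ln_le finite_signs I) auto
  finally show ?thesis by simp
qed

text \<open>A prediction \<open>y\<close> that depends only on \<open>\<tau>\<close> and is right
  about large column sums has correlation of order \<open>sqrt n\<close> with each
  \<open>W j\<close>. As \<open>y\<close> sees \<open>W j\<close> only through its conditional mean,
  that mean has second moment at least \<open>n / 64\<close> for every one of the \<open>t\<close>
  columns.\<close>

lemma gap_majority_fibre_count:
  fixes \<tau> :: "(nat \<times> nat \<Rightarrow> real) \<Rightarrow> 'l" and n t :: nat and y :: "(nat \<times> nat \<Rightarrow> real) \<Rightarrow> nat \<Rightarrow> real"
  defines "I \<equiv> {..<n} \<times> {..<t}" and "W \<equiv> (\<lambda>j x. \<Sum>i<n. x (i, j))"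
  assumes rect: "\<And>x x' z. x \<in> signs I \<Longrightarrow> x' \<in> signs I \<Longrightarrow> z \<in> signs I \<Longrightarrow> \<tau> x = \<tau> x' \<Longrightarrow>
      (\<And>a. (\<forall>c. z (a, c) = x (a, c)) \<or> (\<forall>c. z (a, c) = x' (a, c))) \<Longrightarrow> \<tau> z = \<tau> x"
    and y_fibre: "\<And>x x' j. x \<in> signs I \<Longrightarrow> x' \<in> signs I \<Longrightarrow> \<tau> x = \<tau> x' \<Longrightarrow> y x j = y x' j"
    and y_sign: "\<And>x j. \<bar>y x j\<bar> = 1"
    and bad: "B \<subseteq> signs I" "real (card B) \<le> 1 / 1024 * card (signs I)"
    and good: "\<And>x j. x \<in> signs I - B \<Longrightarrow> j < t \<Longrightarrow> \<bar>W j x\<bar> > g \<Longrightarrow> y x j * W j x = \<bar>W j x\<bar>"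
    and g: "0 \<le> g" "g \<le> sqrt n / 32" and n: "n > 0"
  shows "real (n * t) / 128 \<le> ln (card (\<tau> ` signs I))"
proof -
  have I: "finite I" by (simp add: I_def)
  define w where "w = real (card (signs I))"
  have w: "w > 0" using finite_signs[OF I] signs_nonempty[of I] by (simp add: w_def card_gt_0_iff)
  define s where "s = sqrt (real n)"
  have s: "s > 0" "s * s = n" using n by (auto simp: s_def)
  let ?M = "\<lambda>j. fibre_mean (signs I) \<tau> (W j)"
  have "w * n / 64 \<le> (\<Sum>x\<in>signs I. (?M j x)\<^sup>2)" if j: "j < t" for j
  proof -
    define J where "J = (\<lambda>i. (i, j)) ` {..<n}"
    have J: "J \<subseteq> I" "card J = n" using j by (auto simp: J_def I_def card_image inj_on_def)
    have W: "W j x = (\<Sum>p\<in>J. x p)" for x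
      unfolding J_def W_def by (subst sum.reindex) (auto simp: inj_on_def)
    have abs: "s / 4 * w \<le> (\<Sum>x\<in>signs I. \<bar>W j x\<bar>)"
      using sum_signs_abs_ge[OF I J(1)] J(2) by (simp add: W s_def w_def)
    have sq: "(\<Sum>x\<in>signs I. (W j x)\<^sup>2) = s * s * w"
      using sum_signs_second_moment[OF I J(1)] J(2) s by (simp add: W w_def)
    \<comment> \<open>A wrong prediction loses \<open>2 * \<bar>W j x\<bar>\<close>. This is at most
      \<open>2 * g\<close> inside the gap; on \<open>B\<close> it is split by the
      arithmetic-geometric mean inequality, since \<open>W j\<close> is unbounded relative to
      \<open>s\<close>.\<close>
    have pt: "\<bar>W j x\<bar> - 2 * g - (indicator B x * (32 * s) + (W j x)\<^sup>2 / (32 * s)) \<le> y x j * W j x"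
      if x: "x \<in> signs I" for x
    proof -
      have lo: "- \<bar>W j x\<bar> \<le> y x j * W j x"
        using y_sign[of x j] by (metis abs_ge_minus_self abs_mult mult_1 minus_le_iff)
      have sqs: "0 \<le> (W j x)\<^sup>2 / (32 * s)" using s by simp
      show ?thesis
      proof (cases "x \<in> B")
        case True
        have "0 \<le> (\<bar>W j x\<bar> - 32 * s)\<^sup>2 / (32 * s)" using s by simp
        also have "\<dots> = 32 * s + (W j x)\<^sup>2 / (32 * s) - 2 * \<bar>W j x\<bar>"
          using s(1) by (simp add: power2_diff power2_eq_square field_simps)
        finally show ?thesis using lo True g by simp
      next
        case False
        then show ?thesis
          using good[of x j] x j lo sqs g by (cases "\<bar>W j x\<bar> > g") auto
      qed
    qed
    have "(\<Sum>x\<in>signs I. indicator B x :: real) = card B"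
      using bad(1) finite_signs[OF I] by (simp add: sum.If_cases indicator_def Int_absorb1)
    then have ind: "(\<Sum>x\<in>signs I. indicator B x * (32 * s)) \<le> s / 32 * w"
      using bad(2) s by (simp add: sum_distrib_right[symmetric] w_def)
    \<comment> \<open>Of the first moment \<open>s / 4\<close>, the gap costs \<open>s / 16\<close>,
      and the set \<open>B\<close> and the second moment cost \<open>s / 32\<close> each.\<close>
    have "s / 8 * w \<le> s / 4 * w - 2 * (s / 32) * w - (s / 32 * w + s * s * w / (32 * s))"
      using s(1) by (simp add: field_simps)
    also have "\<dots> \<le> (\<Sum>x\<in>signs I. \<bar>W j x\<bar>) - 2 * g * w
        - ((\<Sum>x\<in>signs I. indicator B x * (32 * s)) + (\<Sum>x\<in>signs I. (W j x)\<^sup>2) / (32 * s))"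
      unfolding sq using abs ind g w by (intro diff_mono add_mono mult_right_mono) (auto simp: s_def)
    also have "\<dots> = (\<Sum>x\<in>signs I. \<bar>W j x\<bar> - 2 * g - (indicator B x * (32 * s) + (W j x)\<^sup>2 / (32 * s)))"
      by (simp add: sum_subtractf sum.distrib sum_divide_distrib w_def mult_ac)
    also have "\<dots> \<le> (\<Sum>x\<in>signs I. y x j * W j x)"
      by (intro sum_mono pt)
    also have "\<dots> = (\<Sum>x\<in>signs I. y x j * ?M j x)"
      by (rule sum_fibre_mean[symmetric]) (auto intro: finite_signs I y_fibre)
    \<comment> \<open>The weights are chosen so that the constant term is half of the lower bound
      \<open>s / 8\<close>.\<close>
    also have "\<dots> \<le> (\<Sum>x\<in>signs I. s / 16 + 4 * (?M j x)\<^sup>2 / s)"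
    proof (rule sum_mono)
      fix x
      have "y x j * ?M j x \<le> \<bar>?M j x\<bar>"
        using y_sign[of x j] by (metis abs_ge_self abs_mult mult_1)
      also have "0 \<le> (s / 4 - 2 * \<bar>?M j x\<bar>)\<^sup>2 / s" using s by simp
      then have "\<bar>?M j x\<bar> \<le> s / 16 + 4 * (?M j x)\<^sup>2 / s"
        using s(1) by (simp add: power2_diff power2_eq_square field_simps)
      finally show "y x j * ?M j x \<le> s / 16 + 4 * (?M j x)\<^sup>2 / s" .
    qed
    also have "\<dots> = s / 16 * w + 4 * (\<Sum>x\<in>signs I. (?M j x)\<^sup>2) / s"
      by (simp add: sum.distrib sum_divide_distrib sum_distrib_left w_def)
    finally have "s / 16 * w \<le> 4 * (\<Sum>x\<in>signs I. (?M j x)\<^sup>2) / s" by simp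
    then have "s * (s / 16 * w) \<le> s * (4 * (\<Sum>x\<in>signs I. (?M j x)\<^sup>2) / s)"
      using s by (intro mult_left_mono) auto
    then show ?thesis
      using s(1) unfolding s(2)[symmetric] by (simp add: mult_ac)
  qed
  then have "(\<Sum>j<t. w * n / 64) \<le> (\<Sum>j<t. \<Sum>x\<in>signs I. (?M j x)\<^sup>2)"
    by (intro sum_mono) auto
  also have "\<dots> \<le> 2 * w * ln (card (\<tau> ` signs I))"
    unfolding w_def W_def I_def by (rule sum_square_fibre_mean_le) (rule rect[unfolded I_def])
  finally have "w * (real (n * t) / 128) \<le> w * ln (card (\<tau> ` signs I))"
    by (simp add: mult_ac)
  then show ?thesis using w by simp
qed

section \<open>Reductions\<close>

text \<open>Row \<open>i\<close> of the pattern goes to site \<open>i\<close>, a sign in column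
  \<open>j\<close> becoming \<open>r\<close> copies of one item. The padding \<open>F\<close> is
  independent of the signs; it lets a reduction adjust frequencies and reach the total size
  \<open>m\<close>.\<close>

definition sign_input ::
  "nat \<Rightarrow> nat \<Rightarrow> nat \<Rightarrow> (nat \<Rightarrow> real \<Rightarrow> nat) \<Rightarrow> nat multiset \<Rightarrow> (nat \<times> nat \<Rightarrow> real) \<Rightarrow> nat \<Rightarrow> nat multiset"
where
  "sign_input n t r v F x i =
     (if i < n then \<Sum>j<t. replicate_mset r (v j (x (i, j))) else {#}) + (if i = 0 then F else {#})"

lemma site_union_sign_input:
  assumes "0 < n" "n \<le> k"
  shows "site_union k (sign_input n t r v F x) = (\<Sum>i<n. \<Sum>j<t. replicate_mset r (v j (x (i, j)))) + F"
proof -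
  have "{..<k} \<inter> {i. i < n} = {..<n}" "{..<k} \<inter> {i. i = 0} = {0}" using assms by auto
  then show ?thesis
    using assms by (simp add: site_union_def sign_input_def sum.distrib sum.If_cases)
qed

lemma size_filter_sum_mset:
  "size {#a \<in># (\<Sum>i\<in>I. M i). Q a#} = (\<Sum>i\<in>I. size {#a \<in># M i. Q a#})"
  by (induction I rule: infinite_finite_induct) auto

lemma size_filter_mset_mono:
  "(\<And>a. P a \<Longrightarrow> Q a) \<Longrightarrow> size {#a \<in># M. P a#} \<le> size {#a \<in># M. Q a#}"
  by (induction M) (auto simp: le_SucI)

lemma size_filter_sign_input:
  assumes "0 < n" "n \<le> k"
  shows "size {#a \<in># site_union k (sign_input n t r v F x). Q a#}
    = (\<Sum>j<t. \<Sum>i<n. if Q (v j (x (i, j))) then r else 0) + size {#a \<in># F. Q a#}"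
proof -
  have "size {#a \<in># replicate_mset r b. Q a#} = (if Q b then r else 0)" for b
    by (induction r) auto
  then show ?thesis
    by (subst sum.swap) (simp add: site_union_sign_input[OF assms] size_filter_sum_mset)
qed

lemma size_sign_input:
  assumes "0 < n" "n \<le> k"
  shows "size (site_union k (sign_input n t r v F x)) = n * t * r + size F"
  using size_filter_sign_input[OF assms, where Q = "\<lambda>_. True"] by simp

text \<open>On signs, the indicator of \<open>x = s\<close> is the affine function
  \<open>(1 + s * x) / 2\<close>, which ties item counts to the column sum.\<close>

lemma sum_sign_indicator:
  fixes n r :: nat and s :: real
  assumes x: "x \<in> signs ({..<n} \<times> {..<t})" and "j < t" and "s = -1 \<or> s = 1"
  shows "real (\<Sum>i<n. if x (i, j) = s then r else 0) = r * (n + s * (\<Sum>i<n. x (i, j))) / 2"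
proof -
  have "real (\<Sum>i<n. if x (i, j) = s then r else 0) = (\<Sum>i<n. r * (1 + s * x (i, j)) / 2)"
    unfolding of_nat_sum
  proof (intro sum.cong refl)
    fix i assume "i \<in> {..<n}"
    then show "real (if x (i, j) = s then r else 0) = r * (1 + s * x (i, j)) / 2"
      using signs_cases[OF x, of "(i, j)"] \<open>j < t\<close> \<open>s = -1 \<or> s = 1\<close> by auto
  qed
  also have "\<dots> = r * (n + s * (\<Sum>i<n. x (i, j))) / 2"
    by (simp add: sum_divide_distrib[symmetric] sum_distrib_left[symmetric] sum.distrib)
  finally show ?thesis .
qed

text \<open>The common part of both reductions: \<open>dec\<close> reads the sign of a column off an
  admissible answer. Fewer than \<open>n * t / 256\<close> bits would leave too few transcripts for
  the fibre count of a deterministic protocol that errs on few patterns.\<close>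

lemma communication_ge:
  fixes R :: "'o det_protocol measure"
  assumes R: "randomized_protocol k R" "computes_with_error (1 / 1024) k N m correct R"
    and n: "0 < n" "n \<le> k" "256 < n * t" and m: "n * t * r + size F = m"
    and v: "\<And>j s. j < t \<Longrightarrow> v j s \<in> {1..N}" and F: "set_mset F \<subseteq> {1..N}"
    and g: "0 \<le> g" "g \<le> sqrt n / 32"
    and decode: "\<And>x j y. x \<in> signs ({..<n} \<times> {..<t}) \<Longrightarrow> j < t \<Longrightarrow>
      correct (site_union k (sign_input n t r v F x)) y \<Longrightarrow> \<bar>\<Sum>i<n. x (i, j)\<bar> > g \<Longrightarrow>
      dec y j \<longleftrightarrow> (\<Sum>i<n. x (i, j)) > 0"
  shows "ereal (real (n * t) / 256) \<le> communication k N m R"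
proof (rule ccontr)
  assume "\<not> ?thesis"
  then have less: "communication k N m R < ereal (real (n * t) / 256)" by simp
  let ?I = "{..<n} \<times> {..<t}" and ?A = "sign_input n t r v F"
  interpret prob_space R using R(1) by (simp add: randomized_protocol_def)
  have A: "?A x \<in> inputs k N m" for x
  proof -
    have "set_mset (?A x i) \<subseteq> {1..N}" for i
      using v F by (auto simp: sign_input_def set_mset_sum)
    then show ?thesis
      using size_sign_input[OF n(1,2)] m by (simp add: inputs_def)
  qed
  from R(2) have "\<forall>x. \<exists>E. E \<in> events \<and>
      {P\<in>space R. \<not> correct (site_union k (?A x)) (output_of P (?A x))} \<subseteq> E \<and> prob E \<le> 1 / 1024"
    unfolding computes_with_error_def using A by blast
  from choice[OF this] obtain E where E: "\<And>x. E x \<in> events" "\<And>x. prob (E x) \<le> 1 / 1024"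
      "\<And>x. {P\<in>space R. \<not> correct (site_union k (?A x)) (output_of P (?A x))} \<subseteq> E x"
    by blast
  obtain P where P: "P \<in> space R"
      "real (card {x\<in>signs ?I. P \<in> E x}) \<le> 1 / 1024 * card (signs ?I)"
    using exists_outcome_in_few_events[of "signs ?I" E "1 / 1024", OF finite_signs E(1,2)] by auto
  define D where "D = nat \<lfloor>real (n * t) / 256\<rfloor>"
  have bits: "bits_of P (?A x) \<le> D" for x
  proof -
    have "ereal (real (bits_of P (?A x))) \<le> communication k N m R"
      unfolding communication_def using A P(1) by (intro SUP_upper2[of P] SUP_upper2[of "?A x"]) auto
    then have "ereal (real (bits_of P (?A x))) < ereal (real (n * t) / 256)"
      using less by (rule le_less_trans)
    then show ?thesis by (simp add: D_def le_nat_iff le_floor_iff)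
  qed
  define \<tau> where "\<tau> x = transcript (fst P) (snd P) (?A x) (\<lambda>_. [])" for x
  define y where "y x j = (if dec (output_of P (?A x)) j then 1 else -1 :: real)" for x j
  have "length (\<tau> x) \<le> D" for x
    unfolding \<tau>_def by (rule order_trans[OF length_transcript_le bits[unfolded bits_of_def]])
  then have "\<tau> ` signs ?I \<subseteq> {xs. length xs \<le> D}" by auto
  moreover have "finite {xs :: bool list. length xs \<le> D}"
    using finite_lists_length_le[of "UNIV :: bool set" D] by simp
  ultimately have "real (card (\<tau> ` signs ?I)) \<le> real (2 ^ Suc D)"
    unfolding of_nat_le_iff by (intro order_trans[OF card_mono card_bool_lists_le])
  moreover have "card (\<tau> ` signs ?I) > 0"
    using finite_signs[of ?I] signs_nonempty[of ?I] by (simp add: card_gt_0_iff)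
  ultimately have "ln (card (\<tau> ` signs ?I)) \<le> ln (2 ^ Suc D)"
    by (subst ln_le_cancel_iff) auto
  also have "\<dots> = Suc D * ln 2"
    by (rule ln_realpow)
  also have "\<dots> \<le> real (Suc D) * 1"
    using ln_le_minus_one[of 2] by (intro mult_left_mono) auto
  finally have up: "ln (card (\<tau> ` signs ?I)) \<le> Suc D" by simp
  have "real (n * t) / 128 \<le> ln (card (\<tau> ` signs ?I))"
  proof (rule gap_majority_fibre_count[where B = "{x\<in>signs ?I. P \<in> E x}" and y = y and g = g])
    fix x x' z
    assume "\<tau> x = \<tau> x'" and row: "\<And>a. (\<forall>c. z (a, c) = x (a, c)) \<or> (\<forall>c. z (a, c) = x' (a, c))"
    \<comment> \<open>Mixing rows of patterns is mixing inputs of sites, so the rectangle property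
      carries over.\<close>
    have "?A z i = ?A x i \<or> ?A z i = ?A x' i" for i
      using row[of i] by (auto simp: sign_input_def)
    then show "\<tau> z = \<tau> x"
      unfolding \<tau>_def by (rule transcript_rectangle[OF \<open>\<tau> x = \<tau> x'\<close>[unfolded \<tau>_def]])
  next
    fix x x' j
    assume "\<tau> x = \<tau> x'"
    then have "output_of P (?A x) = output_of P (?A x')"
      unfolding \<tau>_def output_of_def by (rule output_determined_by_transcript)
    then show "y x j = y x' j" by (simp add: y_def)
  next
    fix x j
    assume x: "x \<in> signs ?I - {x\<in>signs ?I. P \<in> E x}" and "j < t" "g < \<bar>\<Sum>i<n. x (i, j)\<bar>"
    then have "correct (site_union k (?A x)) (output_of P (?A x))"
      using E(3)[of x] P(1) by auto
    then have "dec (output_of P (?A x)) j \<longleftrightarrow> (\<Sum>i<n. x (i, j)) > 0"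
      using x by (intro decode[OF _ \<open>j < t\<close> _ \<open>g < _\<close>]) auto
    then show "y x j * (\<Sum>i<n. x (i, j)) = \<bar>\<Sum>i<n. x (i, j)\<bar>"
      by (simp add: y_def)
  qed (use P g n in \<open>auto simp: y_def\<close>)
  moreover have "real D \<le> real (n * t) / 256"
    unfolding D_def by (rule of_nat_floor) simp
  \<comment> \<open>This absorbs the extra 1 in \<open>Suc D\<close>.\<close>
  moreover have "real (n * t) > 256" using n(3) by linarith
  ultimately show False using up by simp
qed

text \<open>Item \<open>j + 1\<close> collects the positive signs of column \<open>j\<close>, while
  negative signs go to the dummy item \<open>t + 1\<close>. After padding, the frequency of
  \<open>j + 1\<close> is \<open>\<phi> * m\<close> plus half of \<open>r\<close> times the column
  sum, up to rounding, so membership in the answer reveals the sign.\<close>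

lemma heavy_hitters_communication_ge:
  fixes R :: "nat set det_protocol measure" and n t r :: nat and \<epsilon> \<phi> :: real
  assumes R: "randomized_protocol k R" "computes_with_error (1 / 1024) k N m (approx_heavy_hitters N \<epsilon> \<phi>) R"
    and n: "0 < n" "n \<le> k" "256 < n * t" and r: "0 < r" "real r * real n \<le> \<phi> * m" and t: "t * (2 * \<phi>) \<le> 1"
    and N: "t + 1 \<le> N" and g: "max 2 (2 * \<epsilon> * m / r) \<le> sqrt n / 32"
  shows "ereal (real (n * t) / 256) \<le> communication k N m R"
proof -
  define v where "v j s = (if s = 1 then j + 1 else t + 1)" for j :: nat and s :: real
  \<comment> \<open>padding that makes item \<open>j + 1\<close> reach the threshold exactly when its signs are balanced\<close>
  define c where "c = nat \<lfloor>\<phi> * m - r * n / 2\<rfloor>"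
  have c: "\<phi> * m - r * n / 2 - 1 < c" "c \<le> \<phi> * m - r * n / 2"
  proof -
    have "0 \<le> real r * real n" by simp
    then have "0 \<le> \<phi> * m - r * n / 2" using r(2) unfolding of_nat_mult by linarith
    then show "\<phi> * m - r * n / 2 - 1 < c" "c \<le> \<phi> * m - r * n / 2"
      unfolding c_def by linarith+
  qed
  have "0 \<le> real r * real n" by simp
  then have "real r * real n + c \<le> 2 * \<phi> * m"
    using c(2) r(2) unfolding of_nat_mult by linarith
  \<comment> \<open>Each column with its padding is charged at most \<open>2 * \<phi> * m\<close>
    items, so \<open>t\<close> of them fit into \<open>m\<close>; the dummy item takes up the
    rest.\<close>
  then have "t * (real r * real n + c) \<le> t * (2 * \<phi> * m)"
    by (intro mult_left_mono) auto
  then have "real (t * (n * r + c)) \<le> t * (2 * \<phi> * m)"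
    by (simp only: of_nat_mult of_nat_add mult.commute)
  also have "\<dots> = (t * (2 * \<phi>)) * m" by simp
  also have "\<dots> \<le> 1 * real m" by (intro mult_right_mono t) simp
  finally have fits: "t * (n * r + c) \<le> m" by linarith
  define F where "F = (\<Sum>j<t. replicate_mset c (j + 1)) + replicate_mset (m - t * (n * r + c)) (t + 1)"
  have sizeF: "n * t * r + size F = m"
    using fits by (simp add: F_def size_multiset_sum algebra_simps)
  show ?thesis
  proof (rule communication_ge[OF R n sizeF, where v = v and g = "max 2 (2 * \<epsilon> * m / r)"
        and dec = "\<lambda>S j. j + 1 \<in> S"])
    show "set_mset F \<subseteq> {1..N}"
      using N by (auto simp: F_def set_mset_sum)
    show "v j s \<in> {1..N}" if "j < t" for j s
      using N that by (auto simp: v_def)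
  next
    fix x j S
    let ?U = "site_union k (sign_input n t r v F x)" and ?W = "\<Sum>i<n. x (i, j)"
    assume x: "x \<in> signs ({..<n} \<times> {..<t})" and j: "j < t"
      and S: "approx_heavy_hitters N \<epsilon> \<phi> ?U S" and gap: "max 2 (2 * \<epsilon> * m / r) < \<bar>?W\<bar>"
    have size: "size ?U = m" using size_sign_input[OF n(1,2)] sizeF by simp
    have "count ?U (j + 1) = size {#a \<in># ?U. a = j + 1#}"
      by (simp add: filter_eq_replicate_mset)
    also have "\<dots> = (\<Sum>j'<t. \<Sum>i<n. if v j' (x (i, j')) = j + 1 then r else 0) + size {#a \<in># F. a = j + 1#}"
      by (rule size_filter_sign_input[OF n(1,2)])
    also have "(\<Sum>j'<t. \<Sum>i<n. if v j' (x (i, j')) = j + 1 then r else 0)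
        = (\<Sum>j'<t. if j' = j then \<Sum>i<n. if x (i, j) = 1 then r else 0 else 0)"
    proof (intro sum.cong refl)
      fix j' assume "j' \<in> {..<t}"
      then have "v j' s = j + 1 \<longleftrightarrow> j' = j \<and> s = 1" for s
        using j by (auto simp: v_def)
      then show "(\<Sum>i<n. if v j' (x (i, j')) = j + 1 then r else 0)
          = (if j' = j then \<Sum>i<n. if x (i, j) = 1 then r else 0 else 0)"
        by simp
    qed
    also have "\<dots> = (\<Sum>i<n. if x (i, j) = 1 then r else 0)"
      using j by simp
    also have "size {#a \<in># F. a = j + 1#} = count F (j + 1)"
      by (simp add: filter_eq_replicate_mset)
    also have "\<dots> = c"
      using j by (simp add: F_def count_sum)
    finally have count: "real (count ?U (j + 1)) = r * (n + ?W) / 2 + c"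
      using sum_sign_indicator[OF x j, of 1 r] by simp
    show "j + 1 \<in> S \<longleftrightarrow> 0 < ?W"
    proof (cases "0 < ?W")
      case True
      \<comment> \<open>The 2 in the gap pays for the floor in \<open>c\<close>: half of
        \<open>r * ?W\<close> is at least 1.\<close>
      then have "real r * 2 \<le> r * ?W" using gap by (intro mult_left_mono) auto
      then have "1 * 2 \<le> r * ?W" using r(1) by linarith
      then have "\<phi> * m \<le> count ?U (j + 1)"
        using c(1) unfolding count by (simp add: algebra_simps add_divide_distrib)
      then have "j + 1 \<in> heavy_hitters N \<phi> ?U"
        using j N size by (simp add: heavy_hitters_def)
      then show ?thesis using S True by (auto simp: approx_heavy_hitters_def)
    next
      case False
      then have "2 * \<epsilon> * m / r < - ?W" using gap by auto
      then have "2 * \<epsilon> * m < r * - ?W" using r(1) by (simp add: field_simps)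
      then have "count ?U (j + 1) < (\<phi> - \<epsilon>) * m"
        using c(2) unfolding count by (simp add: algebra_simps add_divide_distrib)
      then show ?thesis using S False size by (auto simp: approx_heavy_hitters_def)
    qed
  qed (use g in auto)
qed

text \<open>Column \<open>j\<close> is a block of two consecutive items, \<open>2 * j + 1\<close>
  for negative and \<open>2 * j + 2\<close> for positive signs. A query at the middle of the block
  lands beyond its first item when negative signs are in the minority by more than the gap.\<close>

lemma quantile_communication_ge:
  fixes R :: "(real \<Rightarrow> nat) det_protocol measure" and n t r :: nat and \<epsilon> :: real
  assumes R: "randomized_protocol k R" "computes_with_error (1 / 1024) k N m (approx_all_quantile N \<epsilon>) R"
    and n: "0 < n" "n \<le> k" "256 < n * t" and r: "0 < r" "n * t * r \<le> m"
    and N: "2 * t + 1 \<le> N" and g: "max 2 (2 * \<epsilon> * m / r) \<le> sqrt n / 32"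
  shows "ereal (real (n * t) / 256) \<le> communication k N m R"
proof -
  define v where "v j s = (if s = -1 then 2 * j + 1 else 2 * j + 2)" for j :: nat and s :: real
  \<comment> \<open>The padding lies above all blocks, so it leaves their ranks unchanged.\<close>
  define F where "F = replicate_mset (m - n * t * r) (2 * t + 1)"
  have sizeF: "n * t * r + size F = m" using r(2) by (simp add: F_def)
  have m: "real m > 0" using n(3) r by (cases "m = 0") auto
  define pos where "pos j = j * n * r + r * n / 2" for j :: nat
  show ?thesis
  proof (rule communication_ge[OF R n sizeF, where v = v and g = "max 2 (2 * \<epsilon> * m / r)"
        and dec = "\<lambda>q j. q (pos j / m) > 2 * j + 1"])
    show "set_mset F \<subseteq> {1..N}"
      using N by (auto simp: F_def)
    show "v j s \<in> {1..N}" if "j < t" for j s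
      using N that by (auto simp: v_def)
  next
    fix x j q
    let ?U = "site_union k (sign_input n t r v F x)" and ?W = "\<Sum>i<n. x (i, j)"
    assume x: "x \<in> signs ({..<n} \<times> {..<t})" and j: "j < t"
      and q: "approx_all_quantile N \<epsilon> ?U q" and gap: "max 2 (2 * \<epsilon> * m / r) < \<bar>?W\<bar>"
    have size: "size ?U = m" using size_sign_input[OF n(1,2)] sizeF by simp
    have "size {#a \<in># ?U. a \<le> 2 * j + 1#}
        = (\<Sum>j'<t. \<Sum>i<n. if v j' (x (i, j')) \<le> 2 * j + 1 then r else 0) + size {#a \<in># F. a \<le> 2 * j + 1#}"
      by (rule size_filter_sign_input[OF n(1,2)])
    also have "size {#a \<in># F. a \<le> 2 * j + 1#} = 0"
      using j by (simp add: F_def filter_mset_eq_conv)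
    also have "(\<Sum>j'<t. \<Sum>i<n. if v j' (x (i, j')) \<le> 2 * j + 1 then r else 0)
        = (\<Sum>j'<t. (if j' < j then n * r else 0) + (if j' = j then \<Sum>i<n. if x (i, j) = -1 then r else 0 else 0))"
    proof (intro sum.cong refl)
      fix j'
      have "v j' s \<le> 2 * j + 1 \<longleftrightarrow> j' < j \<or> j' = j \<and> s = -1" for s
        by (auto simp: v_def)
      then show "(\<Sum>i<n. if v j' (x (i, j')) \<le> 2 * j + 1 then r else 0)
          = (if j' < j then n * r else 0) + (if j' = j then \<Sum>i<n. if x (i, j) = -1 then r else 0 else 0)"
        by (cases j' j rule: linorder_cases) auto
    qed
    also have "\<dots> = j * n * r + (\<Sum>i<n. if x (i, j) = -1 then r else 0)"
    proof -
      have "{..<t} \<inter> {j'. j' < j} = {..<j}" using j by auto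
      then show ?thesis using j by (simp add: sum.distrib sum.If_cases)
    qed
    finally have rank: "real (size {#a \<in># ?U. a \<le> 2 * j + 1#}) = pos j - r * ?W / 2"
      using sum_sign_indicator[OF x j, of "-1" r] by (simp add: pos_def field_simps)
    have "pos j \<le> j * n * r + n * r" by (simp add: pos_def)
    also have "\<dots> = real ((j + 1) * (n * r))" by (simp add: algebra_simps)
    also have "\<dots> \<le> real (t * (n * r))"
      using j by (intro of_nat_mono mult_right_mono) auto
    also have "\<dots> \<le> m" using r(2) by (intro of_nat_mono) (simp add: mult_ac)
    finally have "0 \<le> pos j / m" "pos j / m \<le> 1"
      using m by (auto simp: pos_def)
    then have "approx_quantile N \<epsilon> (pos j / m) ?U (q (pos j / m))"
      using q by (simp add: approx_all_quantile_def)
    then obtain \<phi> where \<phi>: "pos j / m - \<epsilon> \<le> \<phi>" "\<phi> \<le> pos j / m + \<epsilon>" "is_quantile N \<phi> ?U (q (pos j / m))"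
      by (auto simp: approx_quantile_def)
    define z where "z = q (pos j / m)"
    \<comment> \<open>The two conditions on a quantile place \<open>\<phi> * m\<close> between the
      number of items below \<open>z\<close> and the number up to \<open>z\<close>.\<close>
    have lo: "real (size {#a \<in># ?U. a < z#}) \<le> \<phi> * m" and "real (size {#a \<in># ?U. a > z#}) \<le> (1 - \<phi>) * m"
      using \<phi>(3) size by (auto simp: is_quantile_def z_def)
    moreover have "size {#a \<in># ?U. a \<le> z#} + size {#a \<in># ?U. a > z#} = m"
      using arg_cong[OF multiset_partition[of ?U "\<lambda>a. a \<le> z"], of size] size by (simp add: not_le)
    ultimately have hi: "\<phi> * m \<le> real (size {#a \<in># ?U. a \<le> z#})"
      by (simp add: algebra_simps flip: of_nat_add)
    have pm: "pos j - \<epsilon> * m \<le> \<phi> * m" "\<phi> * m \<le> pos j + \<epsilon> * m"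
      using \<phi>(1,2) m by (simp_all add: field_simps)
    show "2 * j + 1 < q (pos j / m) \<longleftrightarrow> 0 < ?W"
      unfolding z_def[symmetric]
    proof (cases "2 * j + 1 < z")
      case True
      have "size {#a \<in># ?U. a \<le> 2 * j + 1#} \<le> size {#a \<in># ?U. a < z#}"
        using True by (intro size_filter_mset_mono) auto
      then have "pos j - r * ?W / 2 \<le> pos j + \<epsilon> * m"
        using lo pm rank by linarith
      then have "- ?W \<le> 2 * \<epsilon> * m / r" using r(1) by (simp add: field_simps)
      then show "2 * j + 1 < z \<longleftrightarrow> 0 < ?W" using True gap by auto
    next
      case False
      have "size {#a \<in># ?U. a \<le> z#} \<le> size {#a \<in># ?U. a \<le> 2 * j + 1#}"
        using False by (intro size_filter_mset_mono) auto
      then have "pos j - \<epsilon> * m \<le> pos j - r * ?W / 2"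
        using hi pm rank by linarith
      then have "?W \<le> 2 * \<epsilon> * m / r" using r(1) by (simp add: field_simps)
      then show "2 * j + 1 < z \<longleftrightarrow> 0 < ?W" using False gap by auto
    qed
  qed (use g in auto)
qed

section \<open>Choice of parameters\<close>

lemma nat_floor_half:
  fixes a :: real
  assumes "1 \<le> a"
  shows "1 \<le> nat \<lfloor>a\<rfloor>" "real (nat \<lfloor>a\<rfloor>) \<le> a" "a / 2 \<le> real (nat \<lfloor>a\<rfloor>)"
proof -
  have "1 \<le> \<lfloor>a\<rfloor>" using assms by simp
  then have "real (nat \<lfloor>a\<rfloor>) = of_int \<lfloor>a\<rfloor>" "1 \<le> (of_int \<lfloor>a\<rfloor> :: real)" by simp_all
  then show "1 \<le> nat \<lfloor>a\<rfloor>" "real (nat \<lfloor>a\<rfloor>) \<le> a" "a / 2 \<le> real (nat \<lfloor>a\<rfloor>)"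
    using assms by linarith+
qed

text \<open>In terms of \<open>q = min (sqrt k) (1 / \<epsilon>)\<close> one has
  \<open>\<phi> = \<epsilon> * q / 2\<close> and \<open>X = q / \<epsilon>\<close>. Up to rounding,
  \<open>n\<close> is \<open>q^2 / 65536\<close>, \<open>t\<close> is
  \<open>1 / (\<epsilon> * q)\<close> and \<open>r\<close> is \<open>\<phi> * m / n\<close>, so
  \<open>n * t\<close> has the order of \<open>X\<close>.\<close>

lemma reduction_parameters:
  fixes k N m :: nat and \<epsilon> \<phi> X :: real
  defines "\<phi> \<equiv> min (1 / 2) (\<epsilon> * sqrt k / 2)" and "X \<equiv> min (sqrt k / \<epsilon>) (1 / \<epsilon>\<^sup>2)"
  assumes k: "k \<ge> 2 ^ 28" and \<epsilon>: "0 < \<epsilon>" "\<epsilon> \<le> 1 / 2 ^ 14"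
    and N: "real N \<ge> 3 * max 1 (1 / (\<epsilon> * sqrt k))" and m: "real m \<ge> 3 * X"
  obtains n t r :: nat where "4096 \<le> n" "n \<le> k" "1 \<le> t" "1 \<le> r" "2 * t + 1 \<le> N"
    "real r * real n \<le> \<phi> * m" "t * (2 * \<phi>) \<le> 1" "max 2 (2 * \<epsilon> * m / r) \<le> sqrt n / 32" "X / 2 ^ 18 \<le> real (n * t)"
proof -
  define q where "q = min (sqrt k) (1 / \<epsilon>)"
  have "real (2 ^ 28) \<le> real k" using k by (simp only: of_nat_le_iff)
  then have "sqrt (2 ^ 28) \<le> sqrt (real k)" by (intro real_sqrt_le_mono) simp
  also have "sqrt (2 ^ 28 :: real) = 2 ^ 14" by (rule real_sqrt_unique) auto
  finally have q: "2 ^ 14 \<le> q" using \<epsilon> by (simp add: q_def field_simps)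
  have "q \<le> sqrt k" by (simp add: q_def)
  then have "q\<^sup>2 \<le> (sqrt k)\<^sup>2" using q by (intro power_mono) auto
  then have qk: "q\<^sup>2 \<le> k" by simp
  have u: "0 < \<epsilon> * q" "\<epsilon> * q \<le> 1" using \<epsilon> q by (auto simp: q_def min_def field_simps)
  have \<phi>: "\<phi> = \<epsilon> * q / 2" using \<epsilon> by (auto simp: \<phi>_def q_def min_def field_simps)
  have X: "X = q / \<epsilon>" using \<epsilon> by (auto simp: X_def q_def min_def field_simps power2_eq_square)
  have "max 1 (1 / (\<epsilon> * sqrt k)) = 1 / (\<epsilon> * q)"
  proof (cases "sqrt k \<le> 1 / \<epsilon>")
    case True
    then show ?thesis using u by (simp add: q_def)
  next
    case False
    then have "1 < \<epsilon> * sqrt k" using \<epsilon> by (simp add: field_simps)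
    then show ?thesis using False \<epsilon> by (simp add: q_def)
  qed
  with N have N: "real N \<ge> 3 / (\<epsilon> * q)" by simp
  \<comment> \<open>The gap is at most \<open>8 * n / q\<close> or 2. The former is below
    \<open>sqrt n / 32\<close> when \<open>sqrt n \<le> q / 256\<close>, hence
    \<open>65536 = 256^2\<close>; the latter needs \<open>n \<ge> 4096\<close>, which
    \<open>q \<ge> 2^14\<close> provides.\<close>
  define n where "n = nat \<lfloor>q\<^sup>2 / 65536\<rfloor>"
  have "(2 ^ 14)\<^sup>2 \<le> q\<^sup>2" using q by (intro power_mono) auto
  then have q2: "4096 \<le> q\<^sup>2 / 65536" by simp
  have n: "4096 \<le> n" "n \<le> q\<^sup>2 / 65536" "q\<^sup>2 / 131072 \<le> n"
    using q2 nat_floor_half[of "q\<^sup>2 / 65536"] unfolding n_def by linarith+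
  define t where "t = nat \<lfloor>1 / (\<epsilon> * q)\<rfloor>"
  have u1: "1 \<le> 1 / (\<epsilon> * q)" using u by simp
  have t: "1 \<le> t" "t \<le> 1 / (\<epsilon> * q)" "1 / (\<epsilon> * q) / 2 \<le> t"
    unfolding t_def using nat_floor_half[OF u1] by auto
  define r where "r = nat \<lfloor>\<phi> * m / n\<rfloor>"
  \<comment> \<open>The lower bound on \<open>m\<close> is used to make \<open>r\<close> at least
    1.\<close>
  have "\<epsilon> * q / 2 * (3 * (q / \<epsilon>)) \<le> \<phi> * m"
    using m u unfolding X \<phi> by (intro mult_left_mono) auto
  then have "3 / 2 * q\<^sup>2 \<le> \<phi> * m" using \<epsilon> by (simp add: power2_eq_square)
  then have nm: "real n \<le> \<phi> * m" using n(2) by (simp add: field_simps)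
  then have \<phi>1: "1 \<le> \<phi> * m / n" using n(1) by simp
  have r: "1 \<le> r" "r \<le> \<phi> * m / n" "\<phi> * m / n / 2 \<le> r"
    unfolding r_def using nat_floor_half[OF \<phi>1] by auto
  have n0: "real n > 0" and r0: "real r > 0" and q0: "q > 0" using n(1) r(1) q by auto
  show thesis
  proof (rule that[of n t r])
    show "4096 \<le> n" "1 \<le> t" "1 \<le> r" by fact+
    show "n \<le> k" using n(2) qk by linarith
    have "2 * real t + 1 \<le> 3 * (1 / (\<epsilon> * q))" using t(2) u1 by linarith
    then have "real (2 * t + 1) \<le> real N" using N by simp
    then show "2 * t + 1 \<le> N" by linarith
    show "real r * real n \<le> \<phi> * m" using r(2) n0 by (simp add: field_simps)
    show "t * (2 * \<phi>) \<le> 1" using t(2) u by (simp add: \<phi> field_simps)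
    have "sqrt 4096 \<le> sqrt n" using n(1) by (intro real_sqrt_le_mono) simp
    moreover have "sqrt 4096 = (64 :: real)" by (rule real_sqrt_unique) auto
    ultimately have "2 \<le> sqrt n / 32" by simp
    moreover have "2 * \<epsilon> * m / r \<le> sqrt n / 32"
    proof -
      have "\<epsilon> * q / 2 * m \<le> 2 * n * r" using r(3) n0 by (simp add: \<phi> field_simps)
      then have "2 * \<epsilon> * m / r \<le> 8 * n / q" using r0 q0 by (simp add: field_simps)
      also have "sqrt n \<le> sqrt ((q / 256)\<^sup>2)" using n(2) by (simp add: power_divide)
      then have "sqrt n * sqrt n \<le> q / 256 * sqrt n" using q0 by (intro mult_right_mono) auto
      then have "8 * n / q \<le> sqrt n / 32" using q0 by (simp add: field_simps)
      finally show ?thesis .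
    qed
    ultimately show "max 2 (2 * \<epsilon> * m / r) \<le> sqrt n / 32" by simp
    \<comment> \<open>Rounding \<open>n\<close> and \<open>t\<close> down loses at most a factor 2
      each: \<open>65536 * 2 * 2 = 2^18\<close>.\<close>
    have "X / 2 ^ 18 = (q\<^sup>2 / 131072) * (1 / (\<epsilon> * q) / 2)"
      using \<epsilon> q0 by (simp add: X field_simps power2_eq_square)
    also have "\<dots> \<le> real n * real t"
      using n(3) t(3) u by (intro mult_mono) auto
    finally show "X / 2 ^ 18 \<le> real (n * t)" by simp
  qed
qed

theorem theorem10:
  "\<exists>\<delta>::real. \<delta> > 0 \<and>
    (\<exists>(c::real) (k\<^sub>0::nat) (\<epsilon>\<^sub>0::real) (C::real). c > 0 \<and> \<epsilon>\<^sub>0 > 0 \<and>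
      (\<forall>(k::nat) (\<epsilon>::real) (N::nat) (m::nat).
        k \<ge> k\<^sub>0 \<and> 0 < \<epsilon> \<and> \<epsilon> \<le> \<epsilon>\<^sub>0 \<and>
        real N \<ge> C * max 1 (1 / (\<epsilon> * sqrt (real k))) \<and>
        real m \<ge> C * min (sqrt (real k) / \<epsilon>) (1 / \<epsilon>\<^sup>2) \<longrightarrow>
        (\<forall>R :: (real \<Rightarrow> nat) det_protocol measure.
           randomized_protocol k R \<and>
           computes_with_error \<delta> k N m (approx_all_quantile N \<epsilon>) R \<longrightarrow>
           ereal (c * min (sqrt (real k) / \<epsilon>) (1 / \<epsilon>\<^sup>2)) \<le> communication k N m R) \<and>
        (\<forall>R :: nat set det_protocol measure.
           randomized_protocol k R \<and>
           computes_with_error \<delta> k N m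
             (approx_heavy_hitters N \<epsilon> (min (1 / 2) (\<epsilon> * sqrt (real k) / 2))) R \<longrightarrow>
           ereal (c * min (sqrt (real k) / \<epsilon>) (1 / \<epsilon>\<^sup>2)) \<le> communication k N m R)))"
proof -
  have main: "(\<forall>R. randomized_protocol k R \<and> computes_with_error (1 / 1024) k N m (approx_all_quantile N \<epsilon>) R \<longrightarrow>
         ereal (1 / 2 ^ 26 * min (sqrt (real k) / \<epsilon>) (1 / \<epsilon>\<^sup>2)) \<le> communication k N m R) \<and>
      (\<forall>R. randomized_protocol k R \<and>
         computes_with_error (1 / 1024) k N m
           (approx_heavy_hitters N \<epsilon> (min (1 / 2) (\<epsilon> * sqrt (real k) / 2))) R \<longrightarrow>
         ereal (1 / 2 ^ 26 * min (sqrt (real k) / \<epsilon>) (1 / \<epsilon>\<^sup>2)) \<le> communication k N m R)"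
    (is "(\<forall>R. ?Q R \<longrightarrow> ereal (1 / 2 ^ 26 * ?X) \<le> _) \<and> (\<forall>R. _ R \<and> computes_with_error _ _ _ _ (_ _ _ ?\<phi>) R \<longrightarrow> _)")
    if hyps: "2 ^ 28 \<le> k" "0 < \<epsilon>" "\<epsilon> \<le> 1 / 2 ^ 14"
      "real N \<ge> 3 * max 1 (1 / (\<epsilon> * sqrt (real k)))"
      "real m \<ge> 3 * min (sqrt (real k) / \<epsilon>) (1 / \<epsilon>\<^sup>2)"
    for k N m :: nat and \<epsilon> :: real
  proof -
    obtain n t r :: nat where p: "4096 \<le> n" "n \<le> k" "1 \<le> t" "1 \<le> r" "2 * t + 1 \<le> N"
      "real r * real n \<le> ?\<phi> * m" "t * (2 * ?\<phi>) \<le> 1" "max 2 (2 * \<epsilon> * m / r) \<le> sqrt n / 32"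
      "?X / 2 ^ 18 \<le> real (n * t)"
      by (rule reduction_parameters[OF hyps])
    have "4096 * 1 \<le> n * t" using p by (intro mult_mono) auto
    then have nt: "0 < n" "256 < n * t" using p(1) by auto
    \<comment> \<open>One choice of parameters serves both problems: the size condition for
      quantiles follows from those for heavy hitters.\<close>
    have "real (n * t * r) = t * (real r * real n)" by simp
    also have "\<dots> \<le> t * (?\<phi> * m)" by (intro mult_left_mono p) simp
    also have "\<dots> \<le> (t * (2 * ?\<phi>)) * m" using hyps(2) by simp
    also have "\<dots> \<le> 1 * real m" by (intro mult_right_mono p) simp
    finally have fits: "n * t * r \<le> m" by linarith
    \<comment> \<open>The final constant combines \<open>2^18\<close> from the parameters with 256
      from the communication bound.\<close>
    have "1 / 2 ^ 26 * ?X \<le> real (n * t) / 256" using p(9) by simp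
    then have bound: "ereal (1 / 2 ^ 26 * ?X) \<le> B" if "ereal (real (n * t) / 256) \<le> B" for B
      using that by (meson ereal_less_eq(3) order_trans)
    have r: "0 < r" and N: "t + 1 \<le> N" using p(4,5) by auto
    show ?thesis
      using bound[OF quantile_communication_ge[OF _ _ nt(1) p(2) nt(2) r fits p(5,8)]]
        bound[OF heavy_hitters_communication_ge[OF _ _ nt(1) p(2) nt(2) r p(6,7) N p(8)]]
      by blast
  qed
  show ?thesis
    by (rule exI[of _ "1 / 1024"], rule conjI, simp, rule exI[of _ "1 / 2 ^ 26"], rule exI[of _ "2 ^ 28"],
        rule exI[of _ "1 / 2 ^ 14"], rule exI[of _ 3], rule conjI, simp, rule conjI, simp,
        intro allI impI, elim conjE, rule main)
qed

end
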